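(* Let $r$ and $n$ be integers such that $1 \le r \le n$ and $n \equiv 0 \pmod r$. For $k \ge 2$, if $F_1, F_2, \ldots, F_k$ are graphs on a common set of $n$ vertices, each of which consists of the vertex-disjoint union of $n/r$ copies of $K_r$, then \[ \gamma_{\rm sd}(F_1,F_2,\ldots,F_k) \le \left( 1 - \left( \frac{r-1}{r} \right)^{k-1} \right) n. \]
   Context: All graphs are finite and simple. Given graphs $F_1,\ldots,F_k$ (called factors; not necessarily edge-disjoint) with common vertex set $V$, a set $S \subseteq V$ is a simultaneous dominating set if for every $i$, $1 \le i \le k$, every vertex not in $S$ is adjacent in $F_i$ to some vertex of $S$. The simultaneous domination number $\gamma_{\rm sd}(F_1,\ldots,F_k)$ is the minimum cardinality of a simultaneous dominating set. *)

theory Defs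
  imports Complex_Main "HOL-Library.Disjoint_Sets"
    "Graph_Theory.Pair_Digraph" "Graph_Theory.Kuratowski"
begin

text \<open>
  A finite simple graph is a \<open>pair_graph\<close>: a finite vertex set with a symmetric, irreflexive
  set of arcs, both arcs \<open>(u, v)\<close> and \<open>(v, u)\<close> being present for each edge \<open>uv\<close>.
\<close>

text \<open>
  The library's \<open>K\<^bsub>r\<^esub>\<close> is a predicate that holds of all labelled copies of the complete graph on
  \<open>r\<close> vertices, so the copies below are the graphs \<open>C 0, \<dots>, C (m - 1)\<close>.
\<close>

definition disjoint_union_of_complete :: "nat \<Rightarrow> nat \<Rightarrow> 'a pair_pre_digraph \<Rightarrow> bool" where
  "disjoint_union_of_complete m r G \<longleftrightarrow>
     (\<exists>C :: nat \<Rightarrow> 'a pair_pre_digraph.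
        (\<forall>j<m. K\<^bsub>r\<^esub> (with_proj (C j))) \<and>
        disjoint_family_on (\<lambda>j. pverts (C j)) {..<m} \<and>
        pverts G = (\<Union>j<m. pverts (C j)) \<and>
        parcs G = (\<Union>j<m. parcs (C j)))"

text \<open>
  The factors are \<open>F 1, \<dots>, F k\<close>; values of \<open>F\<close> at other indices are ignored. The notation
  \<open>v \<rightarrow>\<^bsub>G\<^esub> u\<close> says that \<open>(v, u)\<close> is an arc, i.e. adjacency when \<open>G\<close> is symmetric.
\<close>

definition simultaneous_dominating_set ::
    "'a set \<Rightarrow> nat \<Rightarrow> (nat \<Rightarrow> 'a pair_pre_digraph) \<Rightarrow> 'a set \<Rightarrow> bool" where
  "simultaneous_dominating_set V k F S \<longleftrightarrow>
     S \<subseteq> V \<and> (\<forall>i\<in>{1..k}. \<forall>v\<in>V - S. \<exists>u\<in>S. v \<rightarrow>\<^bsub>with_proj (F i)\<^esub> u)"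

definition simultaneous_domination_number ::
    "'a set \<Rightarrow> nat \<Rightarrow> (nat \<Rightarrow> 'a pair_pre_digraph) \<Rightarrow> nat" (\<open>\<gamma>\<^sub>s\<^sub>d\<close>) where
  "\<gamma>\<^sub>s\<^sub>d V k F = (LEAST m. \<exists>S. simultaneous_dominating_set V k F S \<and> card S = m)"

lemma simultaneous_dominating_set_self: "simultaneous_dominating_set V k F V"
  by (simp add: simultaneous_dominating_set_def)

lemma simultaneous_domination_number_attained:
  "\<exists>S. simultaneous_dominating_set V k F S \<and> card S = \<gamma>\<^sub>s\<^sub>d V k F"
  unfolding simultaneous_domination_number_def
  by (rule LeastI_ex) (use simultaneous_dominating_set_self in blast)

lemma simultaneous_domination_number_le:
  "simultaneous_dominating_set V k F S \<Longrightarrow> \<gamma>\<^sub>s\<^sub>d V k F \<le> card S"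
  unfolding simultaneous_domination_number_def by (rule Least_le) blast

end

theory Submission
  imports Defs
begin

text \<open>
  A set that meets every clique of every factor is simultaneously dominating. For two factors, Hall's
  theorem matches the cliques of the first with intersecting cliques of the second, and one point from
  each matched intersection gives a set of \<open>n / r\<close> vertices meeting all of them. Further
  factors are treated greedily: the cliques of the next factor that miss the current set \<open>S\<close> lie in
  its complement, so there are at most \<open>(n - |S|) / r\<close> of them, and adding one vertex of each
  multiplies the size of the complement by at least \<open>(r - 1) / r\<close>.
\<close>

section \<open>Hall's theorem\<close>

text \<open>
  Rado's argument: if some \<open>A i\<close> contains \<open>x \<noteq> y\<close>, then one of the two can be
  deleted from \<open>A i\<close> without violating Hall's condition, by submodularity of
  \<open>J \<mapsto> |\<Union>(A ` J)|\<close>.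
\<close>

lemma hall:
  fixes A :: "'i \<Rightarrow> 'b set"
  assumes "finite I" and "\<And>i. i \<in> I \<Longrightarrow> finite (A i)"
    and "\<And>J. J \<subseteq> I \<Longrightarrow> card J \<le> card (\<Union>(A ` J))"
  shows "\<exists>f. inj_on f I \<and> (\<forall>i\<in>I. f i \<in> A i)"
  using assms(2,3)
\<comment> \<open>The total size of the family is the measure: deleting one point from one
  \<open>A i\<close> lowers it.\<close>
proof (induction "\<Sum>i\<in>I. card (A i)" arbitrary: A rule: less_induct)
  case less
  note finA = less.prems(1) and hallA = less.prems(2)
  have fin: "finite J" "finite (\<Union>(A ` J))" if "J \<subseteq> I" for J
    using that finite_subset[OF that assms(1)] finA by auto
  show ?case
  \<comment> \<open>If no set has two elements, Hall's condition for single indices makes each a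
    singleton, and for pairs it makes these singletons distinct.\<close>
  proof (cases "\<forall>i\<in>I. card (A i) \<le> 1")
    case True
    have "\<exists>a. A i = {a}" if "i \<in> I" for i
    proof -
      have "card (A i) = 1"
        using hallA[of "{i}"] True that by (simp add: le_antisym)
      then show ?thesis
        by (rule card_1_singletonE) blast
    qed
    then obtain f where f: "\<And>i. i \<in> I \<Longrightarrow> A i = {f i}"
      by metis
    have "inj_on f I"
    proof (rule inj_onI, rule ccontr)
      fix i j assume ij: "i \<in> I" "j \<in> I" "f i = f j" "i \<noteq> j"
      then show False
        using hallA[of "{i, j}"] f by simp
    qed
    then show ?thesis
      using f by auto
  next
    case False
    then obtain i where i: "i \<in> I" "\<not> card (A i) \<le> Suc 0"
      by auto
    then obtain x y where xy: "x \<in> A i" "y \<in> A i" "x \<noteq> y"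
      using finA card_le_Suc0_iff_eq by metis
    define R where "R z = A(i := A i - {z})" for z
    \<comment> \<open>If no choice function exists, then by induction the family with
      \<open>z\<close> deleted from \<open>A i\<close> violates Hall's condition at some set. That
      set contains \<open>i\<close>; taking \<open>i\<close> out of it gives the \<open>J\<close>
      here and turns the strict inequality into \<le>.\<close>
    have *: "\<exists>J \<subseteq> I - {i}. card ((A i - {z}) \<union> \<Union>(A ` J)) \<le> card J"
      if z: "z \<in> A i" and none: "\<nexists>f. inj_on f I \<and> (\<forall>i\<in>I. f i \<in> A i)" for z
    proof -
      have "(\<Sum>j\<in>I. card (R z j)) < (\<Sum>j\<in>I. card (A j))"
      proof (rule sum_strict_mono_ex1)
        show "\<forall>j\<in>I. card (R z j) \<le> card (A j)"
          using finA by (auto simp: R_def intro: card_mono)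
        show "\<exists>j\<in>I. card (R z j) < card (A j)"
          using i z finA by (intro bexI[of _ i]) (auto simp: R_def intro: psubset_card_mono)
      qed (fact assms(1))
      moreover have "\<nexists>f. inj_on f I \<and> (\<forall>j\<in>I. f j \<in> R z j)"
        using none by (auto simp: R_def split: if_splits)
      moreover have "finite (R z j)" if "j \<in> I" for j
        using finA[OF that] by (auto simp: R_def)
      ultimately obtain J where J: "J \<subseteq> I" "card (\<Union>(R z ` J)) < card J"
        using less.hyps[of "R z"] by (meson not_le)
      have "i \<in> J"
      proof (rule ccontr)
        assume "i \<notin> J"
        then have "R z ` J = A ` J"
          by (auto simp: R_def intro!: image_cong)
        then show False
          using J hallA[of J] by simp
      qed
      then have "\<Union>(R z ` J) = (A i - {z}) \<union> \<Union>(A ` (J - {i}))"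
        by (auto simp: R_def split: if_splits)
      moreover have "card (J - {i}) = card J - 1"
        using \<open>i \<in> J\<close> by simp
      ultimately show ?thesis
        using J by (intro exI[of _ "J - {i}"]) auto
    qed
    show ?thesis
    proof (rule ccontr)
      assume none: "\<not> ?thesis"
      obtain J where J: "J \<subseteq> I - {i}" "card ((A i - {x}) \<union> \<Union>(A ` J)) \<le> card J"
        using *[OF xy(1) none] by blast
      obtain K where K: "K \<subseteq> I - {i}" "card ((A i - {y}) \<union> \<Union>(A ` K)) \<le> card K"
        using *[OF xy(2) none] by blast
      let ?X = "(A i - {x}) \<union> \<Union>(A ` J)" and ?Y = "(A i - {y}) \<union> \<Union>(A ` K)"
      have sub: "J \<subseteq> I" "K \<subseteq> I" "J \<inter> K \<subseteq> I" "insert i (J \<union> K) \<subseteq> I"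
        using J K i by auto
      note finJK = fin[OF sub(1)] fin[OF sub(2)] and finAi = finA[OF i(1)]
      \<comment> \<open>Since \<open>x\<close> and \<open>y\<close> differ, each is still present in
        the other set, so the union loses nothing. It thus has at least
        \<open>card (J \<union> K) + 1\<close> elements and the intersection at least
        \<open>card (J \<inter> K)\<close>, one more in total than \<open>card J + card K\<close>,
        which bounds the same sum from above.\<close>
      have "?X \<union> ?Y = \<Union>(A ` insert i (J \<union> K))"
        using xy by auto
      then have "card (insert i (J \<union> K)) \<le> card (?X \<union> ?Y)"
        using hallA[OF sub(4)] by simp
      moreover have "card (insert i (J \<union> K)) = Suc (card (J \<union> K))"
        using J K finJK by (subst card_insert_disjoint) auto
      moreover have "card (J \<inter> K) \<le> card (?X \<inter> ?Y)"
        using finJK finAi by (intro order.trans[OF hallA[OF sub(3)]] card_mono) auto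
      moreover have "card ?X + card ?Y = card (?X \<union> ?Y) + card (?X \<inter> ?Y)"
        using finJK finAi by (intro card_Un_Int) auto
      moreover have "card J + card K = card (J \<union> K) + card (J \<inter> K)"
        using finJK by (intro card_Un_Int) auto
      ultimately show False
        using J K by linarith
    qed
  qed
qed

section \<open>Transversals of partitions into blocks of equal size\<close>

definition equipartition :: "'a set \<Rightarrow> nat \<Rightarrow> 'a set set \<Rightarrow> bool" where
  "equipartition V r P \<longleftrightarrow> partition_on V P \<and> (\<forall>p\<in>P. card p = r)"

lemma card_Union_equipartition:
  assumes "finite V" "equipartition V r P" "J \<subseteq> P"
  shows "r * card J = card (\<Union>J)"
proof (rule card_partition)
  show "finite J" "finite (\<Union>J)"
    using assms finite_elements[of V P]
    by (auto simp: equipartition_def partition_on_def intro: finite_subset)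
qed (use assms in \<open>auto simp: equipartition_def partition_on_def disjoint_def\<close>)

text \<open>The blocks in \<open>J\<close> cover \<open>r * card J\<close> points, all of which lie
  in the blocks of \<open>Q\<close> that meet them. As those blocks also have size \<open>r\<close>,
  there are at least \<open>card J\<close> of them, which is Hall's condition.\<close>

lemma common_transversal:
  assumes "finite V" "r > 0" and P: "equipartition V r P" and Q: "equipartition V r Q"
  shows "\<exists>S\<subseteq>V. r * card S \<le> card V \<and> (\<forall>p\<in>P \<union> Q. p \<inter> S \<noteq> {})"
proof -
  have fin: "finite P" "finite Q" and UN: "\<Union>P = V" "\<Union>Q = V"
    using P Q finite_elements[OF assms(1)] by (auto simp: equipartition_def dest: partition_onD1)
  note cardP = card_Union_equipartition[OF assms(1) P]
    and cardQ = card_Union_equipartition[OF assms(1) Q]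
  define A where "A p = {q \<in> Q. p \<inter> q \<noteq> {}}" for p
  have "card J \<le> card (\<Union>(A ` J))" if J: "J \<subseteq> P" for J
  proof -
    have sub: "\<Union>(A ` J) \<subseteq> Q"
      by (auto simp: A_def)
    have "\<Union>J \<subseteq> \<Union>(\<Union>(A ` J))"
    proof
      fix v assume "v \<in> \<Union>J"
      then obtain p where "p \<in> J" "v \<in> p" by auto
      moreover from this obtain q where "q \<in> Q" "v \<in> q"
        using J UN by blast
      ultimately show "v \<in> \<Union>(\<Union>(A ` J))"
        by (auto simp: A_def)
    qed
    moreover have "finite (\<Union>(\<Union>(A ` J)))"
      using sub UN assms(1) by (metis Union_mono finite_subset)
    ultimately have "r * card J \<le> r * card (\<Union>(A ` J))"
      unfolding cardP[OF J] cardQ[OF sub] by (rule card_mono[rotated])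
    then show ?thesis
      using \<open>r > 0\<close> by simp
  qed
  moreover have "finite (A p)" for p
    using fin by (simp add: A_def)
  ultimately have "\<exists>f. inj_on f P \<and> (\<forall>p\<in>P. f p \<in> A p)"
    by (intro hall fin)
  then obtain f where f: "inj_on f P" "\<And>p. p \<in> P \<Longrightarrow> f p \<in> A p"
    by blast
  \<comment> \<open>Both partitions have \<open>card V / r\<close> blocks, so the injective
    \<open>f\<close> is onto \<open>Q\<close>; the points chosen in \<open>p \<inter> f p\<close>
    therefore meet every block of \<open>Q\<close> as well.\<close>
  have "r * card P = r * card Q"
    using cardP[of P] cardQ[of Q] UN by simp
  then have "card (f ` P) = card Q"
    using \<open>r > 0\<close> f(1) by (simp add: card_image)
  then have surj: "f ` P = Q"
    using f(2) fin by (intro card_subset_eq) (auto simp: A_def)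
  have "\<forall>p\<in>P. \<exists>v. v \<in> p \<inter> f p"
    using f(2) by (auto simp: A_def)
  from bchoice[OF this] obtain g where g: "\<forall>p\<in>P. g p \<in> p \<inter> f p" ..
  have "r * card (g ` P) \<le> r * card P"
    using card_image_le[OF fin(1), of g] by simp
  then have "r * card (g ` P) \<le> card V"
    using cardP[of P] UN by simp
  moreover have "g ` P \<subseteq> V"
    using g UN by blast
  moreover have "p \<inter> g ` P \<noteq> {}" if "p \<in> P \<union> Q" for p
    using that g surj by blast
  ultimately show ?thesis
    by blast
qed

text \<open>With \<open>card (V - S) = card V - card S\<close> the bound reads
  \<open>r * card T \<le> (r - 1) * card S + card V\<close>, the recursion iterated over the
  factors.\<close>

lemma extend_transversal:
  assumes "finite V" "r > 0" "equipartition V r P" "S \<subseteq> V"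
  shows "\<exists>T. S \<subseteq> T \<and> T \<subseteq> V \<and> r * card T \<le> r * card S + card (V - S) \<and> (\<forall>p\<in>P. p \<inter> T \<noteq> {})"
proof -
  define U where "U = {p \<in> P. p \<inter> S = {}}"
  have U: "U \<subseteq> P" "\<Union>U \<subseteq> V - S" "finite U" "{} \<notin> P"
    using assms finite_elements[of V P] by (auto simp: U_def equipartition_def partition_on_def)
  obtain g where g: "\<And>p. p \<in> P \<Longrightarrow> g p \<in> p"
    using U(4) by (metis ex_in_conv)
  have "r * card U \<le> card (V - S)"
    using card_Union_equipartition[OF assms(1,3) U(1)] U(2) assms(1)
    by (simp add: card_mono)
  moreover have "card (S \<union> g ` U) \<le> card S + card U"
    using card_Un_le[of S "g ` U"] card_image_le[OF U(3), of g] by linarith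
  then have "r * card (S \<union> g ` U) \<le> r * card S + r * card U"
    by (metis distrib_left mult_le_mono2)
  ultimately have "r * card (S \<union> g ` U) \<le> r * card S + card (V - S)"
    by linarith
  moreover have "p \<inter> (S \<union> g ` U) \<noteq> {}" if "p \<in> P" for p
    using that g[OF that] by (auto simp: U_def)
  moreover have "S \<union> g ` U \<subseteq> V"
    using U(1,2) g assms(4) by blast
  ultimately show ?thesis
    by blast
qed

text \<open>The exponent is \<open>k - 1\<close> because the first two partitions together cost only
  one factor \<open>(r - 1) / r\<close> of the complement; hence the induction starts at
  \<open>k = 2\<close>.\<close>

lemma transversal_of_equipartitions:
  fixes P :: "nat \<Rightarrow> 'a set set"
  assumes "finite V" "r > 0" "2 \<le> k" "\<And>i. i \<in> {1..k} \<Longrightarrow> equipartition V r (P i)"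
  shows "\<exists>S\<subseteq>V. real (card S) \<le> (1 - ((real r - 1) / real r) ^ (k - 1)) * real (card V) \<and>
           (\<forall>i\<in>{1..k}. \<forall>p\<in>P i. p \<inter> S \<noteq> {})"
  using assms(3,4)
proof (induction k rule: dec_induct)
  case base
  obtain S where S: "S \<subseteq> V" "r * card S \<le> card V" "\<forall>p\<in>P 1 \<union> P 2. p \<inter> S \<noteq> {}"
    using common_transversal[OF assms(1,2), of "P 1" "P 2"] base.prems by auto
  have "real r * real (card S) \<le> real (card V)"
    using S(2) by (metis of_nat_le_iff of_nat_mult)
  then have "real (card S) \<le> (1 - ((real r - 1) / real r) ^ (2 - 1)) * real (card V)"
    using \<open>r > 0\<close> by (simp add: field_simps)
  moreover have "{1..2} = {1, 2::nat}"
    by auto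
  ultimately show ?case
    using S by (intro exI[of _ S]) auto
next
  case (step k)
  define q where "q = (real r - 1) / real r"
  have q: "0 \<le> q" "real r * q = real r - 1"
    using \<open>r > 0\<close> by (auto simp: q_def)
  obtain S where S: "S \<subseteq> V" "real (card S) \<le> (1 - q ^ (k - 1)) * real (card V)"
      "\<forall>i\<in>{1..k}. \<forall>p\<in>P i. p \<inter> S \<noteq> {}"
    using step.IH step.prems unfolding q_def by auto
  obtain T where T: "S \<subseteq> T" "T \<subseteq> V" "r * card T \<le> r * card S + card (V - S)"
      "\<forall>p\<in>P (Suc k). p \<inter> T \<noteq> {}"
    using extend_transversal[OF assms(1,2) _ S(1), of "P (Suc k)"] step.prems by auto
  have "real (card (V - S)) = real (card V) - real (card S)"
    using S(1) assms(1) by (simp add: card_Diff_subset finite_subset card_mono of_nat_diff)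
  then have "real r * real (card T) \<le> real r * real (card S) + (real (card V) - real (card S))"
    using T(3) by (metis of_nat_le_iff of_nat_mult of_nat_add)
  \<comment> \<open>Here \<open>r - 1\<close> is written as \<open>r * q\<close>. This coefficient
    of \<open>card S\<close> is nonnegative, so the induction hypothesis can be substituted.\<close>
  also have "\<dots> = real r * q * real (card S) + real (card V)"
    unfolding q(2) by (simp add: algebra_simps)
  also have "\<dots> \<le> real r * q * ((1 - q ^ (k - 1)) * real (card V)) + real (card V)"
    using S(2) q(1) by (intro add_right_mono mult_left_mono) auto
  also have "\<dots> = (real r * q + 1 - real r * (q * q ^ (k - 1))) * real (card V)"
    by (simp add: algebra_simps)
  \<comment> \<open>Uses \<open>r * q + 1 = r\<close>, and \<open>q * q ^ (k - 1) = q ^ k\<close>,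
    valid since \<open>k\<close> is positive.\<close>
  also have "\<dots> = real r * ((1 - q ^ k) * real (card V))"
    using step.hyps q(2) by (simp add: power_eq_if[of q k] algebra_simps)
  finally have "real (card T) \<le> (1 - q ^ (Suc k - 1)) * real (card V)"
    using \<open>r > 0\<close> by simp
  moreover have "p \<inter> T \<noteq> {}" if "i \<in> {1..Suc k}" "p \<in> P i" for i p
  proof (cases "i = Suc k")
    case True
    then show ?thesis
      using that T(4) by blast
  next
    case False
    then have "p \<inter> S \<noteq> {}"
      using that S(3) le_Suc_eq by auto
    then show ?thesis
      using T(1) by blast
  qed
  ultimately show ?case
    using T(2) unfolding q_def by blast
qed

section \<open>From cliques to domination\<close>

text \<open>Replaces a factor by the vertex sets of its cliques; adjacency within blocks is all that
  is needed to pass from meeting every block back to domination.\<close>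

lemma clique_equipartition:
  assumes "disjoint_union_of_complete m r G" "r > 0"
  shows "\<exists>P. equipartition (pverts G) r P \<and>
    (\<forall>p\<in>P. \<forall>u\<in>p. \<forall>v\<in>p. u \<noteq> v \<longrightarrow> u \<rightarrow>\<^bsub>with_proj G\<^esub> v)"
proof -
  obtain C :: "nat \<Rightarrow> 'a pair_pre_digraph"
    where C: "\<And>j. j < m \<Longrightarrow> K\<^bsub>r\<^esub> (with_proj (C j))"
      "disjoint_family_on (\<lambda>j. pverts (C j)) {..<m}"
      "pverts G = (\<Union>j<m. pverts (C j))" "parcs G = (\<Union>j<m. parcs (C j))"
    using assms(1) unfolding disjoint_union_of_complete_def by blast
  have K: "card (pverts (C j)) = r"
    "parcs (C j) = {(u,v). (u,v) \<in> pverts (C j) \<times> pverts (C j) \<and> u \<noteq> v}" if "j < m" for j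
    using C(1)[OF that] by (simp_all add: complete_digraph_pair_def)
  have "{} \<notin> (\<lambda>j. pverts (C j)) ` {..<m}"
    using K(1) \<open>r > 0\<close> by force
  then have "equipartition (pverts G) r ((\<lambda>j. pverts (C j)) ` {..<m})"
    using C(2,3) K(1)
    by (auto simp: equipartition_def partition_on_def disjoint_family_on_disjoint_image)
  moreover have "u \<rightarrow>\<^bsub>with_proj G\<^esub> v"
    if "j < m" "u \<in> pverts (C j)" "v \<in> pverts (C j)" "u \<noteq> v" for j u v
    using that K(2)[OF that(1)] C(4) by auto
  ultimately show ?thesis
    by blast
qed

theorem theorem18:
  fixes r n k :: nat
    and V :: "'a set"
    and F :: "nat \<Rightarrow> 'a pair_pre_digraph"
  assumes "1 \<le> r" and "r \<le> n" and "n mod r = 0"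
    and "2 \<le> k"
    and "finite V" and "card V = n"
    and "\<And>i. i \<in> {1..k} \<Longrightarrow> pair_graph (F i)"
    and "\<And>i. i \<in> {1..k} \<Longrightarrow> pverts (F i) = V"
    and "\<And>i. i \<in> {1..k} \<Longrightarrow> disjoint_union_of_complete (n div r) r (F i)"
  shows "real (\<gamma>\<^sub>s\<^sub>d V k F) \<le> (1 - ((real r - 1) / real r) ^ (k - 1)) * real n"
proof -
  have "r > 0"
    using assms(1) by simp
  have "\<forall>i\<in>{1..k}. \<exists>P. equipartition V r P \<and>
      (\<forall>p\<in>P. \<forall>u\<in>p. \<forall>v\<in>p. u \<noteq> v \<longrightarrow> u \<rightarrow>\<^bsub>with_proj (F i)\<^esub> v)"
    using clique_equipartition[OF assms(9) \<open>r > 0\<close>] assms(8) by simp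
  from bchoice[OF this] obtain P where "\<forall>i\<in>{1..k}. equipartition V r (P i) \<and>
      (\<forall>p\<in>P i. \<forall>u\<in>p. \<forall>v\<in>p. u \<noteq> v \<longrightarrow> u \<rightarrow>\<^bsub>with_proj (F i)\<^esub> v)" ..
  note PF = bspec[OF this]
  have P: "\<And>i. i \<in> {1..k} \<Longrightarrow> equipartition V r (P i)"
    and adj: "\<And>i p u v. \<lbrakk>i \<in> {1..k}; p \<in> P i; u \<in> p; v \<in> p; u \<noteq> v\<rbrakk> \<Longrightarrow> u \<rightarrow>\<^bsub>with_proj (F i)\<^esub> v"
    using PF by auto
  have "\<exists>S\<subseteq>V. real (card S) \<le> (1 - ((real r - 1) / real r) ^ (k - 1)) * real n \<and>
      (\<forall>i\<in>{1..k}. \<forall>p\<in>P i. p \<inter> S \<noteq> {})"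
    using transversal_of_equipartitions[OF assms(5) \<open>r > 0\<close> assms(4) P] assms(6) by simp
  then obtain S where S: "S \<subseteq> V" "real (card S) \<le> (1 - ((real r - 1) / real r) ^ (k - 1)) * real n"
    and meets: "\<And>i p. i \<in> {1..k} \<Longrightarrow> p \<in> P i \<Longrightarrow> p \<inter> S \<noteq> {}"
    by (elim exE conjE) blast
  \<comment> \<open>The block of \<open>v\<close> contains some \<open>u\<close> in
    \<open>S\<close>; it differs from \<open>v\<close>, which lies outside \<open>S\<close>, so the
    two are adjacent.\<close>
  have "\<exists>u\<in>S. v \<rightarrow>\<^bsub>with_proj (F i)\<^esub> u" if i: "i \<in> {1..k}" and v: "v \<in> V - S" for i v
  proof -
    obtain p where p: "p \<in> P i" "v \<in> p"
      using P[OF i] v by (auto simp: equipartition_def partition_on_def)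
    obtain u where "u \<in> p" "u \<in> S"
      using meets[OF i p(1)] by blast
    then show ?thesis
      using adj[OF i p] v by blast
  qed
  then have "\<gamma>\<^sub>s\<^sub>d V k F \<le> card S"
    using S(1) by (intro simultaneous_domination_number_le) (auto simp: simultaneous_dominating_set_def)
  then show ?thesis
    using S(2) by linarith
qed

end
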